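(* Let $L>0$, $\mu>0$, let $f:\mathbb{R}^d\to\mathbb{R}$ be differentiable with $L$-Lipschitz continuous gradient (not necessarily convex), let $h:\mathbb{R}^d\to\mathbb{R}\cup\{+\infty\}$ be closed, proper and convex, and let $F=f+h$ have a nonempty set of global minimizers, with minimum value $F_*$. Let $x_1\in\mathbb{R}^d$, and suppose that $F$ satisfies the Polyak-Łojasiewicz inequality with constant $\mu$ on $X=\{x: F(x)\le F(x_1)\}$, i.e. $$d(0,\partial F(x))^2\ \ge\ 2\mu\,(F(x)-F_* )\qquad\text{for all }x\in X.$$ Let $\gamma\in(0,\tfrac{2}{L})$ and $x_2=\mathrm{prox}_{\gamma h}(x_1-\gamma\nabla f(x_1))$. Then: 1. If $\gamma\in\left(0,\frac{\sqrt3}{L}\right]$, then $$F(x_2)-F_*\le \frac{(L\gamma+1)^2}{(L\gamma+1)^2+L\gamma^2\mu+2\gamma\mu}\,(F(x_1)-F_* ).$$ 2. If $\gamma\in\left(\frac{\sqrt3}{L},\frac{2}{L}\right)$, then $$F(x_2)-F_*\le \frac{(L\gamma-1)^2}{(L\gamma-1)^2-L\gamma^2\mu+2\gamma\mu}\,(F(x_1)-F_* ).$$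
   Context: $\|\cdot\|$ is the Euclidean norm on $\mathbb{R}^d$. For a closed proper convex function $g$, $\mathrm{prox}_{g}(x)=\operatorname{argmin}_{y\in\mathbb{R}^d}\{g(y)+\frac12\|y-x\|^2\}$. $\partial F(x)$ is the Clarke subdifferential, which here equals $\nabla f(x)+\partial h(x)$ with $\partial h$ the convex subdifferential. $d(0,S)=\inf_{s\in S}\|s\|$ for nonempty $S$, with the convention $d(0,\emptyset)=+\infty$. *)

theory Defs
  imports "HOL-Analysis.Analysis"
begin

definition ereal_epigraph :: "('a \<Rightarrow> ereal) \<Rightarrow> ('a \<times> real) set" where
  "ereal_epigraph g = {(x, r). g x \<le> ereal r}"

(* For extended-real-valued functions, convexity and closedness (lower semicontinuity)
   mean convexity and closedness of the epigraph. *)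
definition closed_proper_convex :: "('a::euclidean_space \<Rightarrow> ereal) \<Rightarrow> bool" where
  "closed_proper_convex g \<longleftrightarrow>
     closed (ereal_epigraph g) \<and> convex (ereal_epigraph g) \<and>
     (\<forall>x. g x \<noteq> - \<infinity>) \<and> (\<exists>x. g x \<noteq> \<infinity>)"

definition prox :: "('a::euclidean_space \<Rightarrow> ereal) \<Rightarrow> 'a \<Rightarrow> 'a" where
  "prox g x = arg_min (\<lambda>y. g y + ereal (1 / 2 * (norm (y - x))\<^sup>2)) (\<lambda>_. True)"

(* Sequential form of the Clarke tangent cone; the base points X n range over all
   sequences in C, not only the constant one (which would give the contingent cone). *)
definition clarke_tangent_cone :: "'a::real_normed_vector set \<Rightarrow> 'a \<Rightarrow> 'a set" where
  "clarke_tangent_cone C x =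
     {v. \<forall>X t. (\<forall>n. X n \<in> C) \<and> X \<longlonglongrightarrow> x \<and> (\<forall>n. 0 < t n) \<and> t \<longlonglongrightarrow> (0::real) \<longrightarrow>
           (\<exists>V. V \<longlonglongrightarrow> v \<and> (\<forall>n. X n + t n *\<^sub>R V n \<in> C))}"

definition clarke_normal_cone :: "'a::real_inner set \<Rightarrow> 'a \<Rightarrow> 'a set" where
  "clarke_normal_cone C x = {z. \<forall>v\<in>clarke_tangent_cone C x. z \<bullet> v \<le> 0}"

(* The Clarke subdifferential of an extended-real-valued function, not necessarily locally
   Lipschitz, is defined through the Clarke normal cone of the epigraph.
   It is empty where the function is not finite. *)
definition clarke_subdifferential :: "('a::euclidean_space \<Rightarrow> ereal) \<Rightarrow> 'a \<Rightarrow> 'a set" where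
  "clarke_subdifferential F x =
     (if \<bar>F x\<bar> = \<infinity> then {}
      else {s. (s, - 1) \<in> clarke_normal_cone (ereal_epigraph F) (x, real_of_ereal (F x))})"

(* Extended-real-valued so that the distance to the empty set is \<infinity>;
   the library's infdist and setdist are 0 there. *)
definition dist_zero :: "'a::real_normed_vector set \<Rightarrow> ereal" where
  "dist_zero S = (INF s\<in>S. ereal (norm s))"

end

theory Submission imports Defs begin

text \<open>
  Write \<open>d = x1 - x2\<close> for the step and \<open>\<delta> = gradf x1 - gradf x2\<close> for the change of the gradient.
  Optimality of \<open>x2\<close> in the proximal problem says that \<open>s = d / \<gamma> - gradf x1\<close> is a convex
  subgradient of \<open>h\<close> at \<open>x2\<close>. Hence \<open>gradf x2 + s = d / \<gamma> - \<delta>\<close> is a Clarke subgradient of \<open>F\<close>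
  at \<open>x2\<close>, and the Polyak-Lojasiewicz inequality at \<open>x2\<close> yields
  \<open>2 \<mu> (F x2 - Fstar) \<le> \<parallel>d / \<gamma> - \<delta>\<parallel>\<^sup>2\<close>. It therefore suffices to find \<open>\<kappa> > 0\<close>, as large as possible,
  with \<open>F x1 - F x2 \<ge> \<kappa> \<parallel>d / \<gamma> - \<delta>\<parallel>\<^sup>2\<close>; the contraction factor is then \<open>1 / (1 + 2 \<mu> \<kappa>)\<close>.

  The usual descent lemma bounds \<open>F x1 - F x2\<close> by a multiple of \<open>\<parallel>d\<parallel>\<^sup>2\<close> alone, which is too weak.
  The sharp bound on \<open>f x1 - f x2\<close> (\<open>smooth_interpolation\<close>) also has terms in \<open>\<delta>\<close>; with the
  subgradient inequality for \<open>h\<close> it gives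
  \<open>F x1 - F x2 \<ge> (1/\<gamma> - L/4) \<parallel>d\<parallel>\<^sup>2 - (\<delta> \<bullet> d) / 2 + \<parallel>\<delta>\<parallel>\<^sup>2 / (4 L)\<close>.
  What remains is to compare two quadratic forms in \<open>(d, \<delta>)\<close> on the cone \<open>\<parallel>\<delta>\<parallel> \<le> L \<parallel>d\<parallel>\<close>. The extreme
  directions are \<open>\<delta> = - L d\<close> for short steps and \<open>\<delta> = L d\<close> for long ones; they determine \<open>\<kappa>\<close>, and
  the threshold \<open>L \<gamma> = sqrt 3\<close> is where the coefficient of the remaining square
  \<open>\<parallel>L d + \<delta>\<parallel>\<^sup>2\<close> or \<open>\<parallel>L d - \<delta>\<parallel>\<^sup>2\<close> changes sign.

  The proximal point exists because a minimizer \<open>z\<close> of \<open>F\<close> provides, through the same optimality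
  condition, the affine minorant of \<open>h\<close> with slope \<open>- gradf z\<close>; this makes the proximal objective
  coercive. If \<open>F x1 = \<infinity>\<close>, both bounds are trivial since the contraction factors are positive.
\<close>

section \<open>Functions with Lipschitz gradient\<close>

lemma has_field_derivative_along_line:
  fixes f :: "'a::real_inner \<Rightarrow> real"
  assumes "GDERIV f (x + t *\<^sub>R v) :> g"
  shows "((\<lambda>t. f (x + t *\<^sub>R v)) has_real_derivative g \<bullet> v) (at t)"
proof -
  have "((\<lambda>t. x + t *\<^sub>R v) has_derivative (\<lambda>r. r *\<^sub>R v)) (at t)"
    by (auto intro!: derivative_eq_intros)
  moreover have "(f has_derivative (\<lambda>w. w \<bullet> g)) (at (x + t *\<^sub>R v))"
    using assms by (simp add: gderiv_def)
  ultimately have "((\<lambda>t. f (x + t *\<^sub>R v)) has_derivative (\<lambda>r. (r *\<^sub>R v) \<bullet> g)) (at t)"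
    by (rule has_derivative_compose)
  then show ?thesis
    by (rule has_derivative_imp_has_field_derivative) (simp add: inner_commute)
qed

text \<open>
  Along the segment from \<open>x\<close> to \<open>y\<close> the slope of \<open>f\<close> exceeds its initial value by at most
  \<open>L t \<parallel>y - x\<parallel>\<^sup>2\<close>; integrating over \<open>t\<close> gives the quadratic term.
\<close>

lemma lipschitz_gradient_upper_bound:
  fixes f :: "'a::real_inner \<Rightarrow> real"
  assumes grad: "\<And>x. GDERIV f x :> g x"
    and lip: "L-lipschitz_on UNIV g"
  shows "f y \<le> f x + g x \<bullet> (y - x) + L / 2 * (norm (y - x))\<^sup>2"
proof -
  define v where "v = y - x"
  define \<phi> where "\<phi> = (\<lambda>t. f (x + t *\<^sub>R v) - t * (g x \<bullet> v) - L / 2 * t\<^sup>2 * (norm v)\<^sup>2)"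
  have "\<phi> 1 \<le> \<phi> 0"
  proof (rule DERIV_nonpos_imp_nonincreasing[OF zero_le_one])
    fix t :: real
    assume t: "0 \<le> t" "t \<le> 1"
    have "norm (g (x + t *\<^sub>R v) - g x) \<le> L * (t * norm v)"
      using lipschitz_onD[OF lip, of "x + t *\<^sub>R v" x] t by (simp add: dist_norm)
    then have "(g (x + t *\<^sub>R v) - g x) \<bullet> v \<le> L * (t * norm v) * norm v"
      by (meson norm_cauchy_schwarz norm_ge_zero mult_right_mono order_trans)
    then have "g (x + t *\<^sub>R v) \<bullet> v - g x \<bullet> v - L * t * (norm v)\<^sup>2 \<le> 0"
      by (simp add: inner_diff_left power2_eq_square algebra_simps)
    moreover have "(\<phi> has_real_derivative
        g (x + t *\<^sub>R v) \<bullet> v - g x \<bullet> v - L * t * (norm v)\<^sup>2) (at t)"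
      unfolding \<phi>_def
      by (auto intro!: derivative_eq_intros has_field_derivative_along_line grad)
    ultimately show "\<exists>D. (\<phi> has_real_derivative D) (at t) \<and> D \<le> 0"
      by blast
  qed
  then show ?thesis
    by (simp add: \<phi>_def v_def)
qed

lemma lipschitz_gradient_lower_bound:
  fixes f :: "'a::real_inner \<Rightarrow> real"
  assumes grad: "\<And>x. GDERIV f x :> g x"
    and lip: "L-lipschitz_on UNIV g"
  shows "f x + g x \<bullet> (y - x) - L / 2 * (norm (y - x))\<^sup>2 \<le> f y"
proof -
  have "GDERIV (\<lambda>x. - f x) x :> - g x" for x
    using grad by (rule GDERIV_minus)
  moreover have "L-lipschitz_on UNIV (\<lambda>x. - g x)"
    using lip by (simp add: lipschitz_on_def dist_norm norm_minus_commute)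
  ultimately have "- f y \<le> - f x + - g x \<bullet> (y - x) + L / 2 * (norm (y - x))\<^sup>2"
    by (rule lipschitz_gradient_upper_bound)
  then show ?thesis
    by simp
qed

text \<open>
  The paraboloid touching \<open>f\<close> from above at \<open>x\<close> lies over the one touching it from below at \<open>y\<close>.
  Their gap is a convex quadratic, and evaluating it at its minimizer
  \<open>(x + y) / 2 - (g x - g y) / (2 L)\<close> gives the strongest consequence.
\<close>

lemma smooth_interpolation:
  fixes f :: "'a::real_inner \<Rightarrow> real"
  assumes "0 < L"
    and grad: "\<And>x. GDERIV f x :> g x"
    and lip: "L-lipschitz_on UNIV g"
  shows "f y + (g x + g y) \<bullet> (x - y) / 2 + (norm (g x - g y))\<^sup>2 / (4 * L) - L / 4 * (norm (x - y))\<^sup>2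
         \<le> f x"
proof -
  define d where "d = x - y"
  define \<delta> where "\<delta> = g x - g y"
  define z where "z = x - (1/2) *\<^sub>R d - (1 / (2 * L)) *\<^sub>R \<delta>"
  have zx: "z - x = - ((1/2) *\<^sub>R d + (1 / (2 * L)) *\<^sub>R \<delta>)"
    by (simp add: z_def)
  have "z - y = d + (z - x)"
    by (simp add: d_def)
  also have "\<dots> = (1/2) *\<^sub>R d - (1 / (2 * L)) *\<^sub>R \<delta>"
    unfolding zx by (simp add: algebra_simps flip: scaleR_add_left)
  finally have zy: "z - y = (1/2) *\<^sub>R d - (1 / (2 * L)) *\<^sub>R \<delta>" .
  have gx: "g x = g y + \<delta>"
    by (simp add: \<delta>_def)
  have "f y + g y \<bullet> (z - y) - L / 2 * (norm (z - y))\<^sup>2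
        \<le> f x + g x \<bullet> (z - x) + L / 2 * (norm (z - x))\<^sup>2"
    using lipschitz_gradient_lower_bound[OF grad lip, of y z]
      lipschitz_gradient_upper_bound[OF grad lip, of z x] by linarith
  moreover have "g y \<bullet> (z - y) - g x \<bullet> (z - x) = (g x + g y) \<bullet> d / 2 + (norm \<delta>)\<^sup>2 / (2 * L)"
    unfolding zx zy gx power2_norm_eq_inner
    by (simp add: inner_simps add_divide_distrib algebra_simps)
  moreover have "L / 2 * ((norm (z - y))\<^sup>2 + (norm (z - x))\<^sup>2)
      = L / 4 * (norm d)\<^sup>2 + (norm \<delta>)\<^sup>2 / (4 * L)"
    unfolding zx zy power2_norm_eq_inner using \<open>0 < L\<close>
    by (simp add: inner_simps inner_commute[of d \<delta>] field_simps)
  moreover have "(norm \<delta>)\<^sup>2 / (2 * L) = 2 * ((norm \<delta>)\<^sup>2 / (4 * L))"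
    by simp
  ultimately show ?thesis
    unfolding d_def[symmetric] \<delta>_def[symmetric] distrib_left by linarith
qed

section \<open>Optimality conditions and the proximal point\<close>

text \<open>
  Only the summand \<open>\<phi>\<close> has to be linearized: along the segment from \<open>z\<close> to \<open>y\<close>, convexity bounds
  \<open>h\<close> by its chord, so a violated subgradient inequality would make \<open>\<phi>\<close> plus the chord strictly
  decrease near \<open>z\<close>.
\<close>

lemma minimizer_imp_subgradient:
  fixes \<phi> :: "'a::euclidean_space \<Rightarrow> real"
  assumes conv: "convex (ereal_epigraph h)"
    and hz: "h z = ereal a"
    and grad: "GDERIV \<phi> z :> g"
    and min: "\<And>y. ereal (\<phi> z + a) \<le> ereal (\<phi> y) + h y"
  shows "ereal (a - g \<bullet> (y - z)) \<le> h y"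
proof (rule ereal_le_real)
  fix r
  assume r: "h y \<le> ereal r"
  define v where "v = y - z"
  define \<psi> where "\<psi> = (\<lambda>t. \<phi> (z + t *\<^sub>R v) + t * (r - a))"
  have nondecrease: "\<psi> 0 \<le> \<psi> t" if t: "0 < t" "t \<le> 1" for t
  proof -
    have "(1 - t) *\<^sub>R (z, a) + t *\<^sub>R (y, r) \<in> ereal_epigraph h"
      using t r hz by (intro convexD[OF conv]) (auto simp: ereal_epigraph_def)
    also have "(1 - t) *\<^sub>R (z, a) + t *\<^sub>R (y, r) = (z + t *\<^sub>R v, a + t * (r - a))"
      by (simp add: v_def algebra_simps)
    finally have "h (z + t *\<^sub>R v) \<le> ereal (a + t * (r - a))"
      by (simp add: ereal_epigraph_def)
    then have "ereal (\<phi> (z + t *\<^sub>R v)) + h (z + t *\<^sub>R v)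
        \<le> ereal (\<phi> (z + t *\<^sub>R v)) + ereal (a + t * (r - a))"
      by (rule add_left_mono)
    from order_trans[OF min this] show ?thesis
      by (simp add: \<psi>_def)
  qed
  have "((\<lambda>t. \<phi> (z + t *\<^sub>R v)) has_real_derivative g \<bullet> v) (at 0)"
    using grad by (intro has_field_derivative_along_line) simp
  then have deriv: "(\<psi> has_real_derivative g \<bullet> v + (r - a)) (at 0)"
    unfolding \<psi>_def by (auto intro!: derivative_eq_intros)
  have "0 \<le> g \<bullet> v + (r - a)"
  proof (rule ccontr)
    assume "\<not> 0 \<le> g \<bullet> v + (r - a)"
    then obtain e where e: "0 < e" "\<And>t. 0 < t \<Longrightarrow> t < e \<Longrightarrow> \<psi> t < \<psi> 0"
      using DERIV_neg_dec_right[OF deriv] by force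
    have "0 < min (e/2) 1" "min (e/2) 1 < e" "min (e/2) 1 \<le> 1"
      using e(1) by (simp_all add: min_less_iff_disj)
    then show False
      using e(2) nondecrease not_le by blast
  qed
  then show "ereal (a - g \<bullet> (y - z)) \<le> ereal r"
    by (simp add: v_def)
qed

text \<open>
  A minimizer is found in the epigraph instead of the space, where the objective
  \<open>(y, r) \<mapsto> \<gamma> r + \<parallel>y - p\<parallel>\<^sup>2 / 2\<close> is real-valued and continuous. The affine minorant makes its
  sublevel sets bounded.
\<close>

lemma prox_objective_attains_min:
  fixes h :: "'a::euclidean_space \<Rightarrow> ereal"
  assumes "0 < \<gamma>"
    and clos: "closed (ereal_epigraph h)"
    and hz: "h z = ereal a"
    and minorant: "\<And>y. ereal (a + s \<bullet> (y - z)) \<le> h y"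
  obtains w b where "h w = ereal b"
    and "\<And>y. ereal (\<gamma> * b + 1 / 2 * (norm (w - p))\<^sup>2)
              \<le> ereal \<gamma> * h y + ereal (1 / 2 * (norm (y - p))\<^sup>2)"
proof -
  define G :: "'a \<times> real \<Rightarrow> real" where "G = (\<lambda>(y, r). \<gamma> * r + 1 / 2 * (norm (y - p))\<^sup>2)"
  define S where "S = ereal_epigraph h \<inter> {q. G q \<le> G (z, a)}"
  have contG: "continuous_on A G" for A
    unfolding G_def by (auto simp: case_prod_unfold intro!: continuous_intros)
  have "closed {q. G q \<le> G (z, a)}"
    by (intro closed_Collect_le contG continuous_intros)
  then have "closed S"
    unfolding S_def using clos by (rule closed_Int[rotated])
  \<comment> \<open>Completing the square in the lower bound of the objective by the affine minorant puts the
      first components of \<open>S\<close> in a ball around \<open>p - \<gamma> s\<close>.\<close>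
  define c where "c = p - \<gamma> *\<^sub>R s"
  define K where "K = 2 * (G (z, a) - \<gamma> * (a + s \<bullet> (p - z)) + \<gamma>\<^sup>2 / 2 * (norm s)\<^sup>2)"
  have fst_bound: "(norm (y - c))\<^sup>2 \<le> K" and snd_bound: "a + s \<bullet> (y - z) \<le> r" "r \<le> G (z, a) / \<gamma>"
    if "(y, r) \<in> S" for y r
  proof -
    have "h y \<le> ereal r" and le: "\<gamma> * r + 1 / 2 * (norm (y - p))\<^sup>2 \<le> G (z, a)"
      using that by (auto simp: S_def G_def ereal_epigraph_def)
    then show r: "a + s \<bullet> (y - z) \<le> r"
      using minorant[of y] order_trans ereal_less_eq(3) by blast
    have "\<gamma> * r \<le> G (z, a)"
      using le zero_le_power2[of "norm (y - p)"] by linarith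
    then show "r \<le> G (z, a) / \<gamma>"
      using \<open>0 < \<gamma>\<close> by (simp add: field_simps)
    have "\<gamma> * (a + s \<bullet> (y - z)) \<le> \<gamma> * r"
      using r \<open>0 < \<gamma>\<close> by simp
    moreover have "(norm (y - c))\<^sup>2 =
        (norm (y - p))\<^sup>2 + 2 * \<gamma> * (s \<bullet> (y - z)) - 2 * \<gamma> * (s \<bullet> (p - z)) + \<gamma>\<^sup>2 * (norm s)\<^sup>2"
      unfolding c_def power2_norm_eq_inner
      by (simp add: inner_simps inner_commute power2_eq_square algebra_simps)
    ultimately show "(norm (y - c))\<^sup>2 \<le> K"
      using le by (simp add: K_def algebra_simps)
  qed
  define R where "R = sqrt \<bar>K\<bar>"
  have "S \<subseteq> cball c R \<times> {a - norm s * (R + norm (c - z)) .. G (z, a) / \<gamma>}"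
  proof safe
    fix y r
    assume yr: "(y, r) \<in> S"
    have "norm (y - c) \<le> R"
      unfolding R_def using fst_bound[OF yr] by (intro real_le_rsqrt) linarith
    then show "y \<in> cball c R"
      by (simp add: dist_norm norm_minus_commute)
    have "\<bar>s \<bullet> (y - z)\<bar> \<le> norm s * norm (y - z)"
      by (rule Cauchy_Schwarz_ineq2)
    also have "\<dots> \<le> norm s * (R + norm (c - z))"
      using \<open>norm (y - c) \<le> R\<close> norm_triangle_ineq[of "y - c" "c - z"]
      by (intro mult_left_mono) auto
    finally show "r \<in> {a - norm s * (R + norm (c - z)) .. G (z, a) / \<gamma>}"
      using snd_bound[OF yr] by auto
  qed
  then have "bounded S"
    by (rule bounded_subset[rotated]) (intro bounded_Times bounded_cball bounded_closed_interval)
  with \<open>closed S\<close> have "compact S"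
    by (simp add: compact_eq_bounded_closed)
  moreover have zS: "(z, a) \<in> S"
    by (simp add: S_def ereal_epigraph_def hz)
  ultimately obtain q where "q \<in> S" and q_min: "\<And>q'. q' \<in> S \<Longrightarrow> G q \<le> G q'"
    using continuous_attains_inf[OF _ _ contG] by (metis empty_iff)
  obtain w b where q: "q = (w, b)"
    by (cases q)
  have hw: "h w \<le> ereal b"
    using \<open>q \<in> S\<close> by (simp add: S_def q ereal_epigraph_def)
  have epi_min: "G (w, b) \<le> G (y, r)" if "h y \<le> ereal r" for y r
  proof (cases "G (y, r) \<le> G (z, a)")
    case True
    then show ?thesis
      using that q_min[of "(y, r)"] by (simp add: S_def ereal_epigraph_def q)
  next
    case False
    then show ?thesis
      using q_min[OF zS] by (simp add: q)
  qed
  show ?thesis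
  proof
    obtain b' where b': "h w = ereal b'"
      using minorant[of w] hw by (cases "h w") auto
    have "b \<le> b'"
      using epi_min[of w b'] b' \<open>0 < \<gamma>\<close> by (simp add: G_def)
    then show "h w = ereal b"
      using hw b' by simp
    show "ereal (\<gamma> * b + 1 / 2 * (norm (w - p))\<^sup>2)
              \<le> ereal \<gamma> * h y + ereal (1 / 2 * (norm (y - p))\<^sup>2)" for y
    proof (cases "h y")
      case (real r)
      then show ?thesis
        using epi_min[of y r] by (simp add: G_def)
    next
      case PInf
      then show ?thesis
        using \<open>0 < \<gamma>\<close> by simp
    next
      case MInf
      then show ?thesis
        using minorant[of y] by simp
    qed
  qed
qed

text \<open>
  The stationarity condition of the proximal problem, with the gradient \<open>x - p\<close> of the quadratic
  term at the proximal point \<open>x\<close>.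
\<close>

lemma prox_subgradient:
  fixes h :: "'a::euclidean_space \<Rightarrow> ereal"
  assumes "0 < \<gamma>"
    and clos: "closed (ereal_epigraph h)"
    and conv: "convex (ereal_epigraph h)"
    and hz: "h z = ereal a"
    and minorant: "\<And>y. ereal (a + s \<bullet> (y - z)) \<le> h y"
    and x: "x = prox (\<lambda>y. ereal \<gamma> * h y) p"
  obtains b where "h x = ereal b"
    and "\<And>y. ereal (b + ((1 / \<gamma>) *\<^sub>R (p - x)) \<bullet> (y - x)) \<le> h y"
proof -
  let ?G = "\<lambda>y. ereal \<gamma> * h y + ereal (1 / 2 * (norm (y - p))\<^sup>2)"
  obtain w c where w: "h w = ereal c"
    and w_min: "\<And>y. ereal (\<gamma> * c + 1 / 2 * (norm (w - p))\<^sup>2) \<le> ?G y"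
    using prox_objective_attains_min[OF \<open>0 < \<gamma>\<close> clos hz minorant] by blast
  have "is_arg_min ?G (\<lambda>_. True) w"
    using w_min by (simp add: is_arg_min_def w not_less)
  then have "is_arg_min ?G (\<lambda>_. True) x"
    unfolding x prox_def arg_min_def by (rule someI)
  then have x_min: "?G x \<le> ?G y" for y
    by (auto simp: is_arg_min_def not_less)
  obtain b where b: "h x = ereal b"
    using minorant[of x] x_min[of w] \<open>0 < \<gamma>\<close> w by (cases "h x") auto
  \<comment> \<open>The objective is divided by \<open>\<gamma>\<close> so that \<open>h\<close> itself is the convex summand.\<close>
  have "GDERIV (\<lambda>y. (y - p) \<bullet> (y - p) / (2 * \<gamma>)) x :> (1 / \<gamma>) *\<^sub>R (x - p)"
  proof -
    have "((\<lambda>y. (y - p) \<bullet> (y - p) / (2 * \<gamma>)) has_derivative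
        (\<lambda>w. ((x - p) \<bullet> w + w \<bullet> (x - p)) / (2 * \<gamma>))) (at x)"
      using \<open>0 < \<gamma>\<close> by (auto intro!: derivative_eq_intros simp: field_simps)
    moreover have "((x - p) \<bullet> w + w \<bullet> (x - p)) / (2 * \<gamma>) = w \<bullet> ((1 / \<gamma>) *\<^sub>R (x - p))" for w
      using inner_commute[of "x - p" w] by simp
    ultimately show ?thesis
      by (simp add: gderiv_def)
  qed
  moreover have "ereal ((x - p) \<bullet> (x - p) / (2 * \<gamma>) + b) \<le> ereal ((y - p) \<bullet> (y - p) / (2 * \<gamma>)) + h y"
    for y
  proof (cases "h y")
    case (real r)
    then have "\<gamma> * b + 1 / 2 * (norm (x - p))\<^sup>2 \<le> \<gamma> * r + 1 / 2 * (norm (y - p))\<^sup>2"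
      using x_min[of y] b by simp
    then have "(\<gamma> * b + 1 / 2 * (norm (x - p))\<^sup>2) / \<gamma> \<le> (\<gamma> * r + 1 / 2 * (norm (y - p))\<^sup>2) / \<gamma>"
      using \<open>0 < \<gamma>\<close> by (intro divide_right_mono) simp_all
    then show ?thesis
      using \<open>0 < \<gamma>\<close> real by (simp add: power2_norm_eq_inner add_divide_distrib add.commute)
  next
    case MInf
    then show ?thesis
      using minorant[of y] by simp
  qed simp
  ultimately have "ereal (b - ((1 / \<gamma>) *\<^sub>R (x - p)) \<bullet> (y - x)) \<le> h y" for y
    by (intro minimizer_imp_subgradient[OF conv b])
  moreover have "- (((1 / \<gamma>) *\<^sub>R (x - p)) \<bullet> (y - x)) = ((1 / \<gamma>) *\<^sub>R (p - x)) \<bullet> (y - x)" for y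
    by (simp add: inner_diff_left algebra_simps)
  ultimately show ?thesis
    using that[OF b] by (metis diff_conv_add_uminus)
qed

section \<open>The Clarke subdifferential of the composite function\<close>

text \<open>
  Every Clarke tangent vector \<open>(v, r)\<close> is in particular a limit of difference quotients taken at
  the base point itself. Along these, the lower models of \<open>f\<close> and \<open>h\<close> bound the vertical component
  from below, so in the limit \<open>(g x + s) \<bullet> v \<le> r\<close>. This inclusion of the sum rule is the one
  that bounds the distance of the subdifferential to \<open>0\<close> from above.
\<close>

lemma gradient_plus_subgradient_in_clarke_subdifferential:
  fixes f :: "'a::euclidean_space \<Rightarrow> real"
  assumes grad: "\<And>x. GDERIV f x :> g x"
    and lip: "L-lipschitz_on UNIV g"
    and F: "\<And>x. F x = ereal (f x) + h x"
    and hx: "h x = ereal b"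
    and sub: "\<And>y. ereal (b + s \<bullet> (y - x)) \<le> h y"
  shows "g x + s \<in> clarke_subdifferential F x"
proof -
  have Fx: "F x = ereal (f x + b)"
    by (simp add: F hx)
  have "(g x + s) \<bullet> v \<le> r"
    if tangent: "(v, r) \<in> clarke_tangent_cone (ereal_epigraph F) (x, f x + b)" for v r
  proof -
    define t :: "nat \<Rightarrow> real" where "t = (\<lambda>n. inverse (real (Suc n)))"
    have t_pos: "0 < t n" for n
      by (simp add: t_def)
    have t_lim: "t \<longlonglongrightarrow> 0"
      unfolding t_def by (rule LIMSEQ_inverse_real_of_nat)
    have base: "(x, f x + b) \<in> ereal_epigraph F"
      by (simp add: ereal_epigraph_def Fx)
    have "\<exists>V. V \<longlonglongrightarrow> (v, r) \<and> (\<forall>n. (x, f x + b) + t n *\<^sub>R V n \<in> ereal_epigraph F)"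
      using tangent[unfolded clarke_tangent_cone_def, simplified,
          rule_format, of "\<lambda>_. (x, f x + b)" t] base t_pos t_lim by simp
    then obtain V where V: "V \<longlonglongrightarrow> (v, r)"
      and in_epi: "\<And>n. (x, f x + b) + t n *\<^sub>R V n \<in> ereal_epigraph F"
      by blast
    define u where "u n = fst (V n)" for n
    define \<rho> where "\<rho> n = snd (V n)" for n
    have u_lim: "u \<longlonglongrightarrow> v" and \<rho>_lim: "\<rho> \<longlonglongrightarrow> r"
      unfolding u_def \<rho>_def using tendsto_fst[OF V] tendsto_snd[OF V] by simp_all
    have quotient: "(g x + s) \<bullet> u n - L / 2 * t n * (norm (u n))\<^sup>2 \<le> \<rho> n" for n
    proof -
      have "F (x + t n *\<^sub>R u n) \<le> ereal (f x + b + t n * \<rho> n)"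
        using in_epi[of n] by (simp add: ereal_epigraph_def u_def \<rho>_def case_prod_unfold)
      moreover have "ereal (f (x + t n *\<^sub>R u n) + (b + s \<bullet> (t n *\<^sub>R u n))) \<le> F (x + t n *\<^sub>R u n)"
        using add_left_mono[OF sub[of "x + t n *\<^sub>R u n"], of "ereal (f (x + t n *\<^sub>R u n))"]
        by (simp add: F)
      ultimately have "ereal (f (x + t n *\<^sub>R u n) + (b + s \<bullet> (t n *\<^sub>R u n)))
          \<le> ereal (f x + b + t n * \<rho> n)"
        by (rule order_trans[rotated])
      then have "f (x + t n *\<^sub>R u n) + s \<bullet> (t n *\<^sub>R u n) \<le> f x + t n * \<rho> n"
        by simp
      moreover have "f x + g x \<bullet> (t n *\<^sub>R u n) - L / 2 * (norm (t n *\<^sub>R u n))\<^sup>2 \<le> f (x + t n *\<^sub>R u n)"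
        using lipschitz_gradient_lower_bound[OF grad lip, of x "x + t n *\<^sub>R u n"] by simp
      ultimately have "t n * ((g x + s) \<bullet> u n - L / 2 * t n * (norm (u n))\<^sup>2) \<le> t n * \<rho> n"
        by (simp add: inner_simps power_mult_distrib power2_eq_square algebra_simps)
      then show ?thesis
        using t_pos[of n] by simp
    qed
    have "(\<lambda>n. (g x + s) \<bullet> u n - L / 2 * t n * (norm (u n))\<^sup>2)
        \<longlonglongrightarrow> (g x + s) \<bullet> v - L / 2 * 0 * (norm v)\<^sup>2"
      by (intro tendsto_intros u_lim t_lim)
    then have "(g x + s) \<bullet> v - L / 2 * 0 * (norm v)\<^sup>2 \<le> r"
      using \<rho>_lim quotient by (intro LIMSEQ_le) auto
    then show ?thesis
      by simp
  qed
  then show ?thesis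
    by (auto simp: clarke_subdifferential_def clarke_normal_cone_def Fx)
qed

lemma dist_zero_squared_le:
  assumes "s \<in> S"
  shows "(dist_zero S)\<^sup>2 \<le> ereal ((norm s)\<^sup>2)"
proof -
  have "0 \<le> dist_zero S"
    unfolding dist_zero_def by (auto intro: INF_greatest)
  moreover have "dist_zero S \<le> ereal (norm s)"
    unfolding dist_zero_def using assms by (rule INF_lower)
  ultimately have "dist_zero S * dist_zero S \<le> ereal (norm s) * ereal (norm s)"
    by (intro ereal_mult_mono) auto
  then show ?thesis
    by (simp add: power2_eq_square)
qed

section \<open>Comparison of the quadratic forms\<close>

text \<open>
  The difference of the two sides is a combination, with nonnegative coefficients, of
  \<open>L\<^sup>2 \<parallel>d\<parallel>\<^sup>2 - \<parallel>\<delta>\<parallel>\<^sup>2\<close> and \<open>\<parallel>L d + \<delta>\<parallel>\<^sup>2\<close>, both of which vanish at the extreme direction \<open>\<delta> = - L d\<close>.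
\<close>

lemma short_step_quadratic_bound:
  fixes d \<delta> :: "'a::real_inner"
  assumes "0 < L" "0 < \<gamma>" and short: "(L * \<gamma>)\<^sup>2 \<le> 3"
    and lip: "norm \<delta> \<le> L * norm d"
  shows "\<gamma> * (L * \<gamma> + 2) / (2 * (L * \<gamma> + 1)\<^sup>2) * (norm ((1 / \<gamma>) *\<^sub>R d - \<delta>))\<^sup>2
         \<le> (1 / \<gamma> - L / 4) * (norm d)\<^sup>2 - (\<delta> \<bullet> d) / 2 + (norm \<delta>)\<^sup>2 / (4 * L)"
proof -
  define t where "t = L * \<gamma>"
  have "0 < t"
    using assms by (simp add: t_def)
  have \<gamma>: "\<gamma> = t / L"
    using \<open>0 < L\<close> by (simp add: t_def)
  define A B C where "A = d \<bullet> d" and "B = \<delta> \<bullet> d" and "C = \<delta> \<bullet> \<delta>"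
  have AC: "0 \<le> L\<^sup>2 * A - C"
    using power_mono[OF lip norm_ge_zero, of 2]
    by (simp add: A_def C_def power_mult_distrib power2_norm_eq_inner)
  have square: "0 \<le> L\<^sup>2 * A + 2 * L * B + C"
    using inner_ge_zero[of "L *\<^sub>R d + \<delta>"]
    by (simp add: A_def B_def C_def inner_simps inner_commute[of d \<delta>] power2_eq_square algebra_simps)
  have "(t + 1)\<^sup>2 \<le> 2 * (t + 2)"
    using short[folded t_def] by (simp add: power2_sum)
  then have "0 \<le> (2 * (t + 2) - (t + 1)\<^sup>2) / (4 * L * (t + 1)\<^sup>2)"
    using \<open>0 < L\<close> by simp
  moreover have "0 \<le> 1 / (2 * L * (t + 1))"
    using \<open>0 < L\<close> \<open>0 < t\<close> by simp
  ultimately have "0 \<le> (2 * (t + 2) - (t + 1)\<^sup>2) / (4 * L * (t + 1)\<^sup>2) * (L\<^sup>2 * A + 2 * L * B + C)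
      + 1 / (2 * L * (t + 1)) * (L\<^sup>2 * A - C)"
    by (rule add_nonneg_nonneg[OF mult_nonneg_nonneg[OF _ square] mult_nonneg_nonneg[OF _ AC]])
  also have "\<dots> = (L / t - L / 4) * A - B / 2 + C / (4 * L)
      - t / L * (t + 2) / (2 * (t + 1)\<^sup>2) * (A * (L / t)\<^sup>2 - 2 * B * (L / t) + C)"
  proof -
    \<comment> \<open>With names for the reciprocals, the identity is polynomial modulo their defining equations.\<close>
    define w i j where "w = 1 / (t + 1)" and "i = 1 / L" and "j = 1 / t"
    have "w * (t + 1) = 1" "i * L = 1" "j * t = 1"
      using \<open>0 < L\<close> \<open>0 < t\<close> by (auto simp: w_def i_def j_def)
    then have "(2 * (t + 2) - (t + 1)\<^sup>2) * i * w\<^sup>2 / 4 * (L\<^sup>2 * A + 2 * L * B + C) + i * w / 2 * (L\<^sup>2 * A - C)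
        = (L * j - L / 4) * A - B / 2 + C * i / 4
        - t * i * (t + 2) * w\<^sup>2 / 2 * (A * (L * j)\<^sup>2 - 2 * B * (L * j) + C)"
      by algebra
    then show ?thesis
      using \<open>0 < L\<close> \<open>0 < t\<close> by (simp add: w_def i_def j_def power_divide mult.commute mult.left_commute)
  qed
  finally show ?thesis
    using \<open>0 < L\<close> \<open>0 < t\<close>
    unfolding power2_norm_eq_inner \<gamma>
    by (simp add: A_def B_def C_def inner_simps inner_commute[of d \<delta>] power2_eq_square algebra_simps)
qed

text \<open>
  The extreme direction is now \<open>\<delta> = L d\<close>, and \<open>\<parallel>L d - \<delta>\<parallel>\<^sup>2\<close> takes the role of \<open>\<parallel>L d + \<delta>\<parallel>\<^sup>2\<close>.
\<close>

lemma long_step_quadratic_bound: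
  fixes d \<delta> :: "'a::real_inner"
  assumes "0 < L" "1 < L * \<gamma>" "L * \<gamma> < 2" and long: "3 \<le> (L * \<gamma>)\<^sup>2"
    and lip: "norm \<delta> \<le> L * norm d"
  shows "\<gamma> * (2 - L * \<gamma>) / (2 * (L * \<gamma> - 1)\<^sup>2) * (norm ((1 / \<gamma>) *\<^sub>R d - \<delta>))\<^sup>2
         \<le> (1 / \<gamma> - L / 4) * (norm d)\<^sup>2 - (\<delta> \<bullet> d) / 2 + (norm \<delta>)\<^sup>2 / (4 * L)"
proof -
  define t where "t = L * \<gamma>"
  have t: "1 < t" "t < 2"
    using assms by (simp_all add: t_def)
  have \<gamma>: "\<gamma> = t / L"
    using \<open>0 < L\<close> by (simp add: t_def)
  define A B C where "A = d \<bullet> d" and "B = \<delta> \<bullet> d" and "C = \<delta> \<bullet> \<delta>"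
  have AC: "0 \<le> L\<^sup>2 * A - C"
    using power_mono[OF lip norm_ge_zero, of 2]
    by (simp add: A_def C_def power_mult_distrib power2_norm_eq_inner)
  have square: "0 \<le> L\<^sup>2 * A - 2 * L * B + C"
    using inner_ge_zero[of "L *\<^sub>R d - \<delta>"]
    by (simp add: A_def B_def C_def inner_simps inner_commute[of d \<delta>] power2_eq_square algebra_simps)
  have "2 * (2 - t) \<le> (t - 1)\<^sup>2"
    using long[folded t_def] by (simp add: power2_diff)
  then have "0 \<le> ((t - 1)\<^sup>2 - 2 * (2 - t)) / (4 * L * (t - 1)\<^sup>2)"
    using \<open>0 < L\<close> by simp
  moreover have "0 \<le> (2 - t) / (2 * L * (t - 1))"
    using \<open>0 < L\<close> t by simp
  ultimately have "0 \<le> ((t - 1)\<^sup>2 - 2 * (2 - t)) / (4 * L * (t - 1)\<^sup>2) * (L\<^sup>2 * A - 2 * L * B + C)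
      + (2 - t) / (2 * L * (t - 1)) * (L\<^sup>2 * A - C)"
    by (rule add_nonneg_nonneg[OF mult_nonneg_nonneg[OF _ square] mult_nonneg_nonneg[OF _ AC]])
  also have "\<dots> = (L / t - L / 4) * A - B / 2 + C / (4 * L)
      - t / L * (2 - t) / (2 * (t - 1)\<^sup>2) * (A * (L / t)\<^sup>2 - 2 * B * (L / t) + C)"
  proof -
    \<comment> \<open>With names for the reciprocals, the identity is polynomial modulo their defining equations.\<close>
    define w i j where "w = 1 / (t - 1)" and "i = 1 / L" and "j = 1 / t"
    have "w * (t - 1) = 1" "i * L = 1" "j * t = 1"
      using \<open>0 < L\<close> t by (auto simp: w_def i_def j_def)
    then have "((t - 1)\<^sup>2 - 2 * (2 - t)) * i * w\<^sup>2 / 4 * (L\<^sup>2 * A - 2 * L * B + C) + (2 - t) * i * w / 2 * (L\<^sup>2 * A - C)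
        = (L * j - L / 4) * A - B / 2 + C * i / 4
        - t * i * (2 - t) * w\<^sup>2 / 2 * (A * (L * j)\<^sup>2 - 2 * B * (L * j) + C)"
      by algebra
    then show ?thesis
      using \<open>0 < L\<close> t by (simp add: w_def i_def j_def power_divide mult.commute mult.left_commute)
  qed
  finally show ?thesis
    using \<open>0 < L\<close> t
    unfolding power2_norm_eq_inner \<gamma>
    by (simp add: A_def B_def C_def inner_simps inner_commute[of d \<delta>] power2_eq_square algebra_simps)
qed

section \<open>Linear rate of the proximal gradient step\<close>

text \<open>
  The part common to both step-size regimes: a decrease of \<open>F\<close> by \<open>\<kappa>\<close> times the squared norm of the
  Clarke subgradient \<open>d / \<gamma> - \<delta>\<close> at \<open>x2\<close> turns the Polyak-Lojasiewicz inequality there into a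
  contraction. The decrease also puts \<open>x2\<close> in the sublevel set on which that inequality is assumed.
\<close>

lemma proximal_gradient_contraction:
  fixes f :: "'a::euclidean_space \<Rightarrow> real" and h F :: "'a \<Rightarrow> ereal"
  assumes "0 < L" "0 < \<mu>" "0 < \<gamma>" "0 < \<kappa>"
    and grad: "\<And>x. GDERIV f x :> g x"
    and lip: "L-lipschitz_on UNIV g"
    and h: "closed_proper_convex h"
    and F: "\<And>x. F x = ereal (f x) + h x"
    and z: "is_arg_min F (\<lambda>_. True) z" "F z = ereal Fstar"
    and PL: "\<And>x. F x \<le> F x1 \<Longrightarrow>
           (dist_zero (clarke_subdifferential F x))\<^sup>2 \<ge> ereal (2 * \<mu>) * (F x - ereal Fstar)"
    and x2: "x2 = prox (\<lambda>y. ereal \<gamma> * h y) (x1 - \<gamma> *\<^sub>R g x1)"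
    and decrease: "\<And>d \<delta> :: 'a. norm \<delta> \<le> L * norm d \<Longrightarrow>
           \<kappa> * (norm ((1 / \<gamma>) *\<^sub>R d - \<delta>))\<^sup>2
           \<le> (1 / \<gamma> - L / 4) * (norm d)\<^sup>2 - (\<delta> \<bullet> d) / 2 + (norm \<delta>)\<^sup>2 / (4 * L)"
  shows "F x2 - ereal Fstar \<le> ereal (1 / (1 + 2 * \<mu> * \<kappa>)) * (F x1 - ereal Fstar)"
proof (cases "h x1")
  case PInf
  moreover have "0 < 1 + 2 * \<mu> * \<kappa>"
    using \<open>0 < \<mu>\<close> \<open>0 < \<kappa>\<close> by (simp add: add_pos_pos)
  ultimately show ?thesis
    by (simp add: F)
next
  case MInf
  then show ?thesis
    using h by (simp add: closed_proper_convex_def)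
next
  case (real h1)
  have clos: "closed (ereal_epigraph h)" and conv: "convex (ereal_epigraph h)"
    using h by (simp_all add: closed_proper_convex_def)
  have z_min: "F z \<le> F y" for y
    using z(1) by (simp add: is_arg_min_def not_less)
  obtain a where a: "h z = ereal a"
    using z(2) by (cases "h z") (auto simp: F)
  have "ereal (a - g z \<bullet> (y - z)) \<le> h y" for y
    using z_min by (intro minimizer_imp_subgradient[OF conv a grad]) (simp add: F a)
  then have minorant: "ereal (a + - g z \<bullet> (y - z)) \<le> h y" for y
    by simp
  obtain b where b: "h x2 = ereal b" and sub:
      "\<And>y. ereal (b + ((1 / \<gamma>) *\<^sub>R (x1 - \<gamma> *\<^sub>R g x1 - x2)) \<bullet> (y - x2)) \<le> h y"
    using prox_subgradient[OF \<open>0 < \<gamma>\<close> clos conv a minorant x2] by blast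
  define d where "d = x1 - x2"
  define \<delta> where "\<delta> = g x1 - g x2"
  have s: "(1 / \<gamma>) *\<^sub>R (x1 - \<gamma> *\<^sub>R g x1 - x2) = (1 / \<gamma>) *\<^sub>R d - g x1"
    using \<open>0 < \<gamma>\<close> by (simp add: d_def algebra_simps)
  note sub = sub[unfolded s]
  define F1 F2 where "F1 = f x1 + h1" and "F2 = f x2 + b"
  have Fx1: "F x1 = ereal F1" and Fx2: "F x2 = ereal F2"
    by (simp_all add: F real b F1_def F2_def)
  define N where "N = (norm ((1 / \<gamma>) *\<^sub>R d - \<delta>))\<^sup>2"
  have "\<kappa> * N \<le> F1 - F2"
  proof -
    have "norm \<delta> \<le> L * norm d"
      using lipschitz_onD[OF lip, of x1 x2] by (simp add: \<delta>_def d_def dist_norm)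
    then have "\<kappa> * N \<le> (1 / \<gamma> - L / 4) * (norm d)\<^sup>2 - (\<delta> \<bullet> d) / 2 + (norm \<delta>)\<^sup>2 / (4 * L)"
      unfolding N_def by (rule decrease)
    moreover have "b + ((1 / \<gamma>) *\<^sub>R d - g x1) \<bullet> d \<le> h1"
      using sub[of x1] real by (simp add: d_def)
    moreover have "((1 / \<gamma>) *\<^sub>R d - g x1) \<bullet> d = 1 / \<gamma> * (norm d)\<^sup>2 - g x1 \<bullet> d"
      by (simp add: inner_diff_left power2_norm_eq_inner)
    moreover have "f x2 + (g x1 + g x2) \<bullet> d / 2 + (norm \<delta>)\<^sup>2 / (4 * L) - L / 4 * (norm d)\<^sup>2 \<le> f x1"
      using smooth_interpolation[OF \<open>0 < L\<close> grad lip] by (simp add: d_def \<delta>_def)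
    moreover have "(g x1 + g x2) \<bullet> d / 2 = g x1 \<bullet> d - (\<delta> \<bullet> d) / 2"
      by (simp add: \<delta>_def inner_simps field_simps)
    moreover have "(1 / \<gamma> - L / 4) * (norm d)\<^sup>2 = 1 / \<gamma> * (norm d)\<^sup>2 - L / 4 * (norm d)\<^sup>2"
      by (rule left_diff_distrib)
    ultimately show ?thesis
      unfolding F1_def F2_def by linarith
  qed
  have "0 \<le> \<kappa> * N"
    using \<open>0 < \<kappa>\<close> by (simp add: N_def)
  then have "F x2 \<le> F x1"
    using \<open>\<kappa> * N \<le> F1 - F2\<close> by (simp add: Fx1 Fx2)
  then have "ereal (2 * \<mu>) * (F x2 - ereal Fstar) \<le> (dist_zero (clarke_subdifferential F x2))\<^sup>2"
    by (rule PL)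
  also have "\<dots> \<le> ereal ((norm (g x2 + ((1 / \<gamma>) *\<^sub>R d - g x1)))\<^sup>2)"
    by (intro dist_zero_squared_le gradient_plus_subgradient_in_clarke_subdifferential[OF grad lip F b] sub)
  also have "g x2 + ((1 / \<gamma>) *\<^sub>R d - g x1) = (1 / \<gamma>) *\<^sub>R d - \<delta>"
    by (simp add: \<delta>_def)
  finally have "2 * \<mu> * (F2 - Fstar) \<le> N"
    by (simp add: Fx2 N_def)
  then have "\<kappa> * (2 * \<mu> * (F2 - Fstar)) \<le> \<kappa> * N"
    using \<open>0 < \<kappa>\<close> by simp
  with \<open>\<kappa> * N \<le> F1 - F2\<close> have "(F2 - Fstar) * (1 + 2 * \<mu> * \<kappa>) \<le> F1 - Fstar"
    by (simp add: algebra_simps)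
  moreover have "0 < 1 + 2 * \<mu> * \<kappa>"
    using \<open>0 < \<mu>\<close> \<open>0 < \<kappa>\<close> by (simp add: add_pos_pos)
  ultimately show ?thesis
    by (simp add: Fx1 Fx2 pos_le_divide_eq)
qed

theorem theorem1:
  fixes f :: "real ^ 'd \<Rightarrow> real"
    and gradf :: "real ^ 'd \<Rightarrow> real ^ 'd"
    and h F :: "real ^ 'd \<Rightarrow> ereal"
    and L \<mu> \<gamma> Fstar :: real
    and x1 x2 :: "real ^ 'd"
  assumes "L > 0" and "\<mu> > 0"
    and "\<And>x. GDERIV f x :> gradf x"
    and "L-lipschitz_on UNIV gradf"
    and "closed_proper_convex h"
    and "\<And>x. F x = ereal (f x) + h x"
    and "\<exists>z. is_arg_min F (\<lambda>_. True) z \<and> F z = ereal Fstar"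
    and "\<And>x. x \<in> {x. F x \<le> F x1} \<Longrightarrow>
           (dist_zero (clarke_subdifferential F x))\<^sup>2 \<ge> ereal (2 * \<mu>) * (F x - ereal Fstar)"
    and "\<gamma> \<in> {0 <..< 2 / L}"
    and "x2 = prox (\<lambda>y. ereal \<gamma> * h y) (x1 - \<gamma> *\<^sub>R gradf x1)"
  shows "(\<gamma> \<in> {0 <.. sqrt 3 / L} \<longrightarrow>
            F x2 - ereal Fstar \<le>
              ereal ((L * \<gamma> + 1)\<^sup>2 / ((L * \<gamma> + 1)\<^sup>2 + L * \<gamma>\<^sup>2 * \<mu> + 2 * \<gamma> * \<mu>)) * (F x1 - ereal Fstar))
       \<and> (\<gamma> \<in> {sqrt 3 / L <..< 2 / L} \<longrightarrow>
            F x2 - ereal Fstar \<le>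
              ereal ((L * \<gamma> - 1)\<^sup>2 / ((L * \<gamma> - 1)\<^sup>2 - L * \<gamma>\<^sup>2 * \<mu> + 2 * \<gamma> * \<mu>)) * (F x1 - ereal Fstar))"
proof -
  obtain z where z: "is_arg_min F (\<lambda>_. True) z" "F z = ereal Fstar"
    using assms(7) by blast
  have \<gamma>: "0 < \<gamma>" "L * \<gamma> < 2"
    using assms(1,9) by (auto simp: field_simps)
  note contraction = proximal_gradient_contraction[OF assms(1,2) \<gamma>(1) _ assms(3-6) z _ assms(10)]
  show ?thesis
  proof (intro conjI impI)
    assume "\<gamma> \<in> {0<..sqrt 3 / L}"
    then have "L * \<gamma> \<le> sqrt 3"
      using assms(1) by (simp add: field_simps)
    then have short: "(L * \<gamma>)\<^sup>2 \<le> 3"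
      using assms(1) \<gamma>(1) power_mono[of "L * \<gamma>" "sqrt 3" 2] by simp
    define \<kappa> where "\<kappa> = \<gamma> * (L * \<gamma> + 2) / (2 * (L * \<gamma> + 1)\<^sup>2)"
    have "0 < L * \<gamma>"
      using assms(1) \<gamma>(1) by simp
    then have "0 < \<kappa>"
      using \<gamma>(1) by (simp add: \<kappa>_def)
    then have "F x2 - ereal Fstar \<le> ereal (1 / (1 + 2 * \<mu> * \<kappa>)) * (F x1 - ereal Fstar)"
      using assms(8) short_step_quadratic_bound[OF assms(1) \<gamma>(1) short]
      by (intro contraction) (auto simp: \<kappa>_def)
    also have "1 / (1 + 2 * \<mu> * \<kappa>) =
        (L * \<gamma> + 1)\<^sup>2 / ((L * \<gamma> + 1)\<^sup>2 + L * \<gamma>\<^sup>2 * \<mu> + 2 * \<gamma> * \<mu>)"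
    proof -
      have "1 + 2 * \<mu> * \<kappa> =
          ((L * \<gamma> + 1)\<^sup>2 + L * \<gamma>\<^sup>2 * \<mu> + 2 * \<gamma> * \<mu>) / (L * \<gamma> + 1)\<^sup>2"
        using \<open>0 < L * \<gamma>\<close> by (simp add: \<kappa>_def divide_simps) algebra
      then show ?thesis
        by simp
    qed
    finally show "F x2 - ereal Fstar \<le>
        ereal ((L * \<gamma> + 1)\<^sup>2 / ((L * \<gamma> + 1)\<^sup>2 + L * \<gamma>\<^sup>2 * \<mu> + 2 * \<gamma> * \<mu>)) * (F x1 - ereal Fstar)" .
  next
    assume "\<gamma> \<in> {sqrt 3 / L<..<2 / L}"
    then have "sqrt 3 \<le> L * \<gamma>"
      using assms(1) by (simp add: field_simps)
    then have long: "3 \<le> (L * \<gamma>)\<^sup>2"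
      using power_mono[of "sqrt 3" "L * \<gamma>" 2] by simp
    have "1 < sqrt 3"
      by simp
    then have "1 < L * \<gamma>"
      using \<open>sqrt 3 \<le> L * \<gamma>\<close> by linarith
    define \<kappa> where "\<kappa> = \<gamma> * (2 - L * \<gamma>) / (2 * (L * \<gamma> - 1)\<^sup>2)"
    have "0 < \<kappa>"
      using \<gamma> \<open>1 < L * \<gamma>\<close> by (simp add: \<kappa>_def)
    then have "F x2 - ereal Fstar \<le> ereal (1 / (1 + 2 * \<mu> * \<kappa>)) * (F x1 - ereal Fstar)"
      using assms(8) long_step_quadratic_bound[OF assms(1) \<open>1 < L * \<gamma>\<close> \<gamma>(2) long]
      by (intro contraction) (auto simp: \<kappa>_def)
    also have "1 / (1 + 2 * \<mu> * \<kappa>) =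
        (L * \<gamma> - 1)\<^sup>2 / ((L * \<gamma> - 1)\<^sup>2 - L * \<gamma>\<^sup>2 * \<mu> + 2 * \<gamma> * \<mu>)"
    proof -
      have "1 + 2 * \<mu> * \<kappa> =
          ((L * \<gamma> - 1)\<^sup>2 - L * \<gamma>\<^sup>2 * \<mu> + 2 * \<gamma> * \<mu>) / (L * \<gamma> - 1)\<^sup>2"
        using \<open>1 < L * \<gamma>\<close> by (simp add: \<kappa>_def divide_simps) algebra
      then show ?thesis
        by simp
    qed
    finally show "F x2 - ereal Fstar \<le>
        ereal ((L * \<gamma> - 1)\<^sup>2 / ((L * \<gamma> - 1)\<^sup>2 - L * \<gamma>\<^sup>2 * \<mu> + 2 * \<gamma> * \<mu>)) * (F x1 - ereal Fstar)" .
  qed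
qed

end
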